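(* For all integers $r \geq s \geq 3$ and every real $\epsilon > 0$, there exist $m_0$ and $\delta > 0$ such that the following holds. If $m \geq m_0$ and $G$ is a $K_{r+1}$-free graph with $m$ edges such that \[ \kappa_s(G) \geq (1-\delta)\,\mathrm{mex}_{K_s}(m, K_{r+1}), \] then $G$ can be made $r$-partite by deleting at most $\epsilon m$ edges.
   Context: All graphs are finite and simple. For a graph $G$, $\kappa_s(G)$ denotes the number of copies of $K_s$ (number of $s$-cliques) in $G$. For graphs $T$ and $F$, $\mathrm{mex}_T(m,F)$ is the maximum number of copies of $T$ in an $F$-free graph with exactly $m$ edges, where no restriction is placed on the number of vertices. *)

theory Defs
  imports Complex_Main "HOL-Library.Ramsey" "HOL-Library.Disjoint_Sets"
begin

type_synonym 'a graph = "'a set \<times> 'a set set"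

abbreviation verts :: "'a graph \<Rightarrow> 'a set" where "verts \<equiv> fst"

abbreviation edges :: "'a graph \<Rightarrow> 'a set set" where "edges \<equiv> snd"

definition simple_graph :: "'a graph \<Rightarrow> bool" where
  "simple_graph G \<longleftrightarrow> finite (verts G) \<and> edges G \<subseteq> nsets (verts G) 2"

definition subgraph :: "'a graph \<Rightarrow> 'a graph \<Rightarrow> bool" where
  "subgraph H G \<longleftrightarrow> simple_graph H \<and> verts H \<subseteq> verts G \<and> edges H \<subseteq> edges G"

definition isomorphic :: "'a graph \<Rightarrow> 'b graph \<Rightarrow> bool" where
  "isomorphic G H \<longleftrightarrow> (\<exists>f. bij_betw f (verts G) (verts H) \<and> edges H = (image f) ` edges G)"

text \<open>Copies are unlabelled: a copy is a (not necessarily induced) subgraph, not an embedding.\<close>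

definition copies :: "'b graph \<Rightarrow> 'a graph \<Rightarrow> 'a graph set" where
  "copies T G = {H. subgraph H G \<and> isomorphic H T}"

definition free :: "'b graph \<Rightarrow> 'a graph \<Rightarrow> bool" where
  "free F G \<longleftrightarrow> copies F G = {}"

definition complete_graph :: "nat \<Rightarrow> nat graph" where
  "complete_graph n = ({..<n}, nsets {..<n} 2)"

definition kappa :: "nat \<Rightarrow> 'a graph \<Rightarrow> nat" where
  "kappa s G = card (copies (complete_graph s) G)"

text \<open>Every finite graph is isomorphic to one with vertices in \<^typ>\<open>nat\<close>, so the maximum may be
  taken over graphs on natural numbers. The set is finite and nonempty in the cases of interest
  (see below), so that \<^const>\<open>Max\<close> is a genuine maximum.\<close>

definition mex :: "'b graph \<Rightarrow> nat \<Rightarrow> 'c graph \<Rightarrow> nat" where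
  "mex T m F = Max {card (copies T G) | G :: nat graph.
     simple_graph G \<and> card (edges G) = m \<and> free F G}"

text \<open>Parts may be empty.\<close>

definition partite :: "nat \<Rightarrow> 'a graph \<Rightarrow> bool" where
  "partite r G \<longleftrightarrow> (\<exists>P. (\<Union>i<r. P i) = verts G \<and> disjoint_family_on P {..<r} \<and>
     (\<forall>i<r. indep (P i) (edges G)))"

definition delete_edges :: "'a graph \<Rightarrow> 'a set set \<Rightarrow> 'a graph" where
  "delete_edges G D = (verts G, edges G - D)"

lemma isomorphic_complete_iff:
  assumes "simple_graph H"
  shows "isomorphic H (complete_graph s) \<longleftrightarrow> card (verts H) = s \<and> edges H = nsets (verts H) 2"
proof
  assume "isomorphic H (complete_graph s)"
  then obtain f where f: "bij_betw f (verts H) {..<s}" and e: "nsets {..<s} 2 = image f ` edges H"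
    by (auto simp: isomorphic_def complete_graph_def)
  have sub: "edges H \<subseteq> nsets (verts H) 2" using assms by (auto simp: simple_graph_def)
  have b: "bij_betw (image f) (nsets (verts H) 2) (nsets {..<s} 2)"
    using bij_betw_nsets[OF f] .
  then have "edges H = nsets (verts H) 2"
    using sub e unfolding bij_betw_def
    by (intro inj_on_image_eq_iff[THEN iffD1, of "image f" "nsets (verts H) 2"]) auto
  moreover have "card (verts H) = s" using bij_betw_same_card[OF f] by simp
  ultimately show "card (verts H) = s \<and> edges H = nsets (verts H) 2" by simp
next
  assume a: "card (verts H) = s \<and> edges H = nsets (verts H) 2"
  have "finite (verts H)" using assms by (auto simp: simple_graph_def)
  then obtain f where f: "bij_betw f (verts H) {..<s}"
    using a by (metis bij_betw_iff_card card_lessThan finite_lessThan)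
  have "bij_betw (image f) (nsets (verts H) 2) (nsets {..<s} 2)"
    using bij_betw_nsets[OF f] .
  then show "isomorphic H (complete_graph s)"
    using f a by (auto simp: isomorphic_def complete_graph_def bij_betw_def)
qed

lemma kappa_eq_card_cliques:
  assumes "simple_graph G"
  shows "kappa s G = card {S. S \<subseteq> verts G \<and> card S = s \<and> clique S (edges G)}"
proof -
  have fin: "finite (verts G)" using assms by (auto simp: simple_graph_def)
  have iff: "nsets S 2 \<subseteq> edges G \<longleftrightarrow> clique S (edges G)" for S
  proof
    show "clique S (edges G)" if "nsets S 2 \<subseteq> edges G"
      unfolding clique_def
    proof (intro ballI impI)
      fix v w assume "v \<in> S" "w \<in> S" "v \<noteq> w"
      then have "{v, w} \<in> nsets S 2" by simp
      with that show "{v, w} \<in> edges G" by (rule subsetD)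
    qed
    show "nsets S 2 \<subseteq> edges G" if "clique S (edges G)"
      using that by (auto simp: clique_def elim!: nsets2_E)
  qed
  have "copies (complete_graph s) G
      = (\<lambda>S. (S, nsets S 2)) ` {S. S \<subseteq> verts G \<and> card S = s \<and> clique S (edges G)}" (is "?L = ?R")
  proof (intro subset_antisym subsetI)
    fix H assume "H \<in> ?L"
    then have "subgraph H G" and "isomorphic H (complete_graph s)" by (auto simp: copies_def)
    then have "verts H \<subseteq> verts G" "card (verts H) = s" "nsets (verts H) 2 \<subseteq> edges G"
      and H: "H = (verts H, nsets (verts H) 2)"
      using isomorphic_complete_iff[of H s] by (simp_all add: subgraph_def prod_eq_iff)
    then have "verts H \<in> {S. S \<subseteq> verts G \<and> card S = s \<and> clique S (edges G)}"
      by (simp add: iff)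
    with H show "H \<in> ?R" by (rule image_eqI)
  next
    fix H assume "H \<in> ?R"
    then obtain S where S: "H = (S, nsets S 2)" "S \<subseteq> verts G" "card S = s" "clique S (edges G)"
      by auto
    then have "simple_graph H" using finite_subset[OF _ fin] by (simp add: simple_graph_def)
    then show "H \<in> ?L"
      using S iff[of S] isomorphic_complete_iff[of H s] by (simp add: copies_def subgraph_def)
  qed
  then show ?thesis by (simp add: kappa_def card_image inj_on_def)
qed

lemma finite_mex_complete:
  assumes "s \<ge> 2"
  shows "finite {card (copies (complete_graph s) G) | G :: nat graph.
     simple_graph G \<and> card (edges G) = m \<and> free F G}"
proof (rule finite_subset)
  show "finite {..2 ^ m :: nat}" by simp
  show "{card (copies (complete_graph s) G) | G :: nat graph.
     simple_graph G \<and> card (edges G) = m \<and> free F G} \<subseteq> {..2 ^ m}"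
  proof safe
    fix V :: "nat set" and E
    assume G: "simple_graph (V, E)"
    have finE: "finite E"
      using G finite_subset[OF _ finite_imp_finite_nsets[of V 2]] by (simp add: simple_graph_def)
    let ?C = "copies (complete_graph s) (V, E)"
    have *: "verts H = \<Union> (edges H)" "edges H \<subseteq> E" if "H \<in> ?C" for H
    proof -
      from that have H: "subgraph H (V, E)" "isomorphic H (complete_graph s)"
        by (auto simp: copies_def)
      then have sH: "simple_graph H" by (auto simp: subgraph_def)
      then have k: "card (verts H) = s" "edges H = nsets (verts H) 2"
        using H isomorphic_complete_iff[OF sH] by simp_all
      have "\<exists>y\<in>verts H. y \<noteq> x" if "x \<in> verts H" for x
      proof (rule ccontr)
        assume "\<not> (\<exists>y\<in>verts H. y \<noteq> x)"
        then have "verts H = {x}" using that by blast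
        then show False using k(1) assms by simp
      qed
      then have "x \<in> \<Union> (nsets (verts H) 2)" if "x \<in> verts H" for x
        using that doubleton_in_nsets_2[of x _ "verts H"] by (metis UnionI insertI1)
      moreover have "\<Union> (nsets (verts H) 2) \<subseteq> verts H" by (auto simp: nsets_def)
      ultimately show "verts H = \<Union> (edges H)" unfolding k(2) by (intro subset_antisym subsetI) auto
      show "edges H \<subseteq> E" using H by (auto simp: subgraph_def)
    qed
    have "inj_on edges ?C"
    proof (rule inj_onI)
      fix H H' assume "H \<in> ?C" "H' \<in> ?C" "edges H = edges H'"
      then show "H = H'" using *(1)[of H] *(1)[of H'] by (simp add: prod_eq_iff)
    qed
    then have "card ?C \<le> card (Pow E)"
      using *(2) finE by (intro card_inj_on_le[of edges ?C "Pow E"]) (simp_all add: image_subset_iff)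
    then show "card ?C \<le> 2 ^ card (edges (V, E))" using finE by (simp add: card_Pow)
  qed
qed

lemma nonempty_mex_complete:
  assumes "r \<ge> 2"
  shows "{card (copies T G) | G :: nat graph.
     simple_graph G \<and> card (edges G) = m \<and> free (complete_graph (r + 1)) G} \<noteq> {}"
proof -
  define G :: "nat graph" where "G = ({..m}, (\<lambda>i. {0, i}) ` {1..m})"
  have s: "simple_graph G" by (auto simp: simple_graph_def G_def nsets_def card_insert_if)
  have c: "card (edges G) = m"
    unfolding G_def by (auto simp: card_image inj_on_def doubleton_eq_iff)
  have "free (complete_graph (r + 1)) G"
  proof (rule ccontr)
    assume "\<not> free (complete_graph (r + 1)) G"
    then obtain H where H: "subgraph H G" "isomorphic H (complete_graph (r + 1))"
      by (auto simp: free_def copies_def)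
    have sH: "simple_graph H" using H by (auto simp: subgraph_def)
    have k: "card (verts H) = r + 1" "edges H = nsets (verts H) 2" and fin: "finite (verts H)"
      using isomorphic_complete_iff[OF sH, of "r + 1"] H sH by (auto simp: simple_graph_def)
    have "card (verts H - {0}) \<ge> 2" using k fin assms by (auto simp: card_Diff_singleton_if)
    then obtain x y where xy: "x \<in> verts H - {0}" "y \<in> verts H - {0}" "x \<noteq> y"
      by (metis card_le_Suc0_iff_eq fin finite_Diff not_less_eq_eq numeral_2_eq_2)
    then have "{x, y} \<in> edges H" using k by (auto simp: nsets_2_eq)
    then show False using H xy by (auto simp: subgraph_def G_def doubleton_eq_iff)
  qed
  then show ?thesis using s c by blast
qed

end

theory Submission
  imports Defs
begin

text \<open>Let \<open>q = sqrt (m / (r choose 2))\<close> be the part size of the balanced complete \<open>r\<close>-partite graph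
  with \<open>m\<close> edges. By Zykov's theorem, deleting a vertex of degree \<open>x (r - 1) q\<close> with \<open>x \<le> 1\<close> destroys
  at most \<open>((r - 1) choose (s - 1)) (x q) ^ (s - 1)\<close> cliques, while the upper bound
  \<open>(r choose s) q ^ s\<close> drops by about \<open>((r - 1) choose (s - 1)) x q ^ (s - 1)\<close>, so the gap to the bound
  does not grow. If no such vertex is left, there are at most \<open>r q\<close> vertices, and Zykov's theorem
  gives the bound.

  If \<open>x \<le> 1 - \<eta>\<close>, then, as \<open>s \<ge> 3\<close>, the gap shrinks by a fixed multiple of \<open>q ^ (s - 2)\<close> for
  every deleted edge. Hence a nearly extremal graph reaches minimum degree \<open>(1 - \<eta>) (r - 1) q\<close>
  after losing few edges. The remaining graph has at most \<open>r q / (1 - \<eta>)\<close> vertices, so it is nearly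
  a Turan graph by density, and Furedi's stability argument makes it \<open>r\<close>-partite.\<close>

section \<open>Counting cliques\<close>

text \<open>The edge set stays fixed while \<open>W\<close> varies, so that deleting vertices only
  shrinks \<open>W\<close> and an induced subgraph needs no graph of its own.\<close>

definition cliques :: "'a set set \<Rightarrow> nat \<Rightarrow> 'a set \<Rightarrow> 'a set set" where
  "cliques E k W = {S. S \<subseteq> W \<and> card S = k \<and> clique S E}"

abbreviation nclq :: "'a set set \<Rightarrow> nat \<Rightarrow> 'a set \<Rightarrow> nat" where
  "nclq E k W \<equiv> card (cliques E k W)"

definition nbrs :: "'a set set \<Rightarrow> 'a \<Rightarrow> 'a set" where
  "nbrs E v = {u. u \<noteq> v \<and> {v, u} \<in> E}"

lemma finite_cliques: "finite W \<Longrightarrow> finite (cliques E k W)"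
  unfolding cliques_def by (rule finite_subset[of _ "Pow W"]) auto

lemma cliques_mono: "W \<subseteq> W' \<Longrightarrow> cliques E k W \<subseteq> cliques E k W'"
  unfolding cliques_def by auto

lemma nclq_mono: "finite W' \<Longrightarrow> W \<subseteq> W' \<Longrightarrow> nclq E k W \<le> nclq E k W'"
  by (intro card_mono finite_cliques cliques_mono)

lemma nclq_0: "finite W \<Longrightarrow> nclq E 0 W = 1"
proof -
  assume "finite W"
  then have "cliques E 0 W = {{}}"
    unfolding cliques_def by (auto dest: finite_subset simp: clique_def)
  then show ?thesis by simp
qed

lemma nclq_1: "nclq E 1 W = card W"
proof -
  have "cliques E 1 W = (\<lambda>v. {v}) ` W"
    unfolding cliques_def by (auto simp: card_1_singleton_iff clique_def)
  then show ?thesis by (simp add: card_image)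
qed

lemma nclq_empty: "k > 0 \<Longrightarrow> nclq E k {} = 0"
  unfolding cliques_def by auto

text \<open>A clique either avoids \<open>v\<close> or is \<open>v\<close> together with a clique,
  smaller by one, in the neighbourhood of \<open>v\<close>.\<close>

lemma nclq_Suc_eq:
  assumes "finite W" "v \<in> W"
  shows "nclq E (Suc k) W = nclq E (Suc k) (W - {v}) + nclq E k (W \<inter> nbrs E v)"
proof -
  have split: "cliques E (Suc k) W =
      cliques E (Suc k) (W - {v}) \<union> insert v ` cliques E k (W \<inter> nbrs E v)" (is "?L = ?A \<union> ?B")
  proof (intro subset_antisym subsetI)
    fix S assume S: "S \<in> ?L"
    show "S \<in> ?A \<union> ?B"
    proof (cases "v \<in> S")
      case True
      have fin: "finite S" using S assms(1) by (auto simp: cliques_def dest: finite_subset)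
      have "S - {v} \<in> cliques E k (W \<inter> nbrs E v)"
        using S True fin by (auto simp: cliques_def nbrs_def clique_def)
      moreover have "S = insert v (S - {v})" using True by auto
      ultimately show ?thesis by blast
    next
      case False
      then show ?thesis using S by (auto simp: cliques_def)
    qed
  next
    fix S assume "S \<in> ?A \<union> ?B"
    then show "S \<in> ?L"
    proof
      assume "S \<in> ?B"
      then obtain T where T: "S = insert v T" "T \<subseteq> W \<inter> nbrs E v" "card T = k" "clique T E"
        by (auto simp: cliques_def)
      have "finite T" "v \<notin> T" using T assms(1) by (auto dest: finite_subset simp: nbrs_def)
      then show ?thesis using T assms(2)
        by (auto simp: cliques_def clique_def nbrs_def insert_commute)
    qed (auto simp: cliques_def)
  qed
  have "inj_on (insert v) (cliques E k (W \<inter> nbrs E v))"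
    by (rule inj_onI) (auto simp: cliques_def nbrs_def)
  moreover have "?A \<inter> ?B = {}" by (auto simp: cliques_def)
  ultimately show ?thesis
    unfolding split using assms(1) by (subst card_Un_disjoint) (auto simp: finite_cliques card_image)
qed

lemma nclq_free_nbrs:
  assumes "finite W" "v \<in> W" "nclq E (Suc r) W = 0"
  shows "nclq E r (W \<inter> nbrs E v) = 0"
  using nclq_Suc_eq[OF assms(1,2), of E r] assms(3) by simp

text \<open>Delete the vertices of \<open>X\<close> one by one and charge each clique meeting
  \<open>X\<close> to the first of its vertices to go. Taking neighbourhoods in all of
  \<open>W\<close> makes this an inequality.\<close>

lemma nclq_Diff_le:
  assumes "finite W" "X \<subseteq> W"
  shows "nclq E (Suc k) W \<le> nclq E (Suc k) (W - X) + (\<Sum>v\<in>X. nclq E k (W \<inter> nbrs E v))"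
proof -
  have "finite X" using assms finite_subset by auto
  then show ?thesis using assms(2)
  proof (induction X)
    case (insert v X)
    have "nclq E (Suc k) (W - X)
        = nclq E (Suc k) (W - insert v X) + nclq E k ((W - X) \<inter> nbrs E v)"
      using nclq_Suc_eq[of "W - X" v E k] insert assms(1) unfolding Diff_insert[of W v X] by simp
    moreover have "nclq E k ((W - X) \<inter> nbrs E v) \<le> nclq E k (W \<inter> nbrs E v)"
      using assms(1) by (intro nclq_mono) auto
    ultimately show ?case using insert by simp
  qed simp
qed

text \<open>For edges the count is exact: the degree sum over \<open>X\<close> counts the edges
  inside \<open>X\<close> twice, hence the extra term on the left. Furedi's argument rests on this
  term.\<close>

lemma nclq_2_Diff_eq:
  assumes "finite W" "X \<subseteq> W"
  shows "nclq E 2 W + nclq E 2 X = nclq E 2 (W - X) + (\<Sum>v\<in>X. card (W \<inter> nbrs E v))"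
proof -
  have "finite X" using assms finite_subset by auto
  then show ?thesis using assms(2)
  proof (induction X)
    case empty
    then show ?case by (simp add: nclq_empty)
  next
    case (insert v X)
    have "nclq E 2 (W - X) = nclq E 2 (W - insert v X) + card ((W - X) \<inter> nbrs E v)"
      using nclq_Suc_eq[of "W - X" v E 1] insert assms(1) unfolding Diff_insert[of W v X]
      by (simp add: nclq_1[unfolded One_nat_def] numeral_2_eq_2)
    moreover have "nclq E 2 (insert v X) = nclq E 2 X + card (X \<inter> nbrs E v)"
      using nclq_Suc_eq[of "insert v X" v E 1] insert
      by (simp add: nclq_1[unfolded One_nat_def] numeral_2_eq_2 nbrs_def)
    moreover have "card (W \<inter> nbrs E v) = card (X \<inter> nbrs E v) + card ((W - X) \<inter> nbrs E v)"
    proof -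
      have "W \<inter> nbrs E v = (X \<inter> nbrs E v) \<union> ((W - X) \<inter> nbrs E v)" using insert by auto
      moreover have "finite X" using insert by simp
      ultimately show ?thesis using assms(1) by (simp only:) (rule card_Un_disjoint, auto)
    qed
    ultimately show ?case using insert by simp
  qed
qed

lemma handshake:
  assumes "finite W"
  shows "(\<Sum>v\<in>W. card (W \<inter> nbrs E v)) = 2 * nclq E 2 W"
  using nclq_2_Diff_eq[OF assms order_refl, of E] by (simp add: nclq_empty)

lemma obtain_max:
  fixes f :: "'a \<Rightarrow> nat"
  assumes "finite W" "W \<noteq> {}"
  obtains x where "x \<in> W" "\<And>v. v \<in> W \<Longrightarrow> f v \<le> f x"
proof -
  have "Max (f ` W) \<in> f ` W" using assms by simp
  then obtain x where "x \<in> W" "f x = Max (f ` W)" by auto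
  then show thesis using assms that by simp
qed

section \<open>Convexity, Zykov's theorem and Furedi's partition\<close>

text \<open>By convexity, a power lies above its tangent at \<open>a\<close>. In the induction,
  multiplying by \<open>c\<close> leaves the nonnegative remainder
  \<open>Suc k * a ^ k * (c - a)^2\<close>.\<close>

lemma power_tangent_le:
  fixes a c :: real
  assumes "0 \<le> a" "0 \<le> c"
  shows "a ^ Suc k + Suc k * a ^ k * (c - a) \<le> c ^ Suc k"
proof (induction k)
  case (Suc k)
  have "c ^ Suc (Suc k) = c * c ^ Suc k" by simp
  also have "\<dots> \<ge> c * (a ^ Suc k + Suc k * a ^ k * (c - a))"
    using Suc assms(2) by (intro mult_left_mono) auto
  also have "c * (a ^ Suc k + Suc k * a ^ k * (c - a)) =
     a ^ Suc (Suc k) + Suc (Suc k) * a ^ Suc k * (c - a) + Suc k * a ^ k * (c - a)^2"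
    by (simp add: algebra_simps power2_eq_square)
  finally show ?case using assms by (smt (verit) mult_nonneg_nonneg of_nat_0_le_iff zero_le_power zero_le_power2)
qed simp

text \<open>The left side is the \<open>k + 1\<close>-st elementary symmetric polynomial at \<open>(b, \<dots>, b, y)\<close>, so this
  is the only case of Maclaurin's inequality that is needed.\<close>

lemma choose_mean_le:
  fixes b y :: real
  assumes "0 \<le> b" "0 \<le> y"
  shows "(r choose Suc k) * b ^ Suc k + (r choose k) * b ^ k * y
    \<le> (Suc r choose Suc k) * ((r * b + y) / Suc r) ^ Suc k"
proof -
  define c where "c = (r * b + y) / Suc r"
  have c: "Suc r * c = r * b + y" by (simp add: c_def)
  have abs: "real (Suc k) * (Suc r choose Suc k) = Suc r * (r choose k)"
    using Suc_times_binomial_eq[of r k] by (metis mult.commute of_nat_mult)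
  \<comment> \<open>The tangent at \<open>b\<close> already gives the left side of the goal: by the
    absorption identity \<open>abs\<close>, its linear term is
    \<open>(r choose k) * b ^ k * (y - b)\<close>.\<close>
  have 1: "(Suc r choose Suc k) * (b ^ Suc k + Suc k * b ^ k * (c - b)) \<le> (Suc r choose Suc k) * c ^ Suc k"
    using assms by (intro mult_left_mono power_tangent_le) (auto simp: c_def)
  have 2: "(Suc r choose Suc k) * (b ^ Suc k + Suc k * b ^ k * (c - b))
    = (Suc r choose Suc k) * b ^ Suc k + (r choose k) * b ^ k * (Suc r * c - Suc r * b)"
    using arg_cong[OF abs, of "\<lambda>z. z * (b ^ k * (c - b))"] by (simp only: algebra_simps of_nat_mult)
  have 3: "Suc r * c - Suc r * b = y - b" unfolding c by (simp add: algebra_simps)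
  have 4: "real (Suc r choose Suc k) * b ^ Suc k + (r choose k) * b ^ k * (y - b)
     = (r choose Suc k) * b ^ Suc k + (r choose k) * b ^ k * y"
    by (simp add: algebra_simps)
  show ?thesis using 1 unfolding 2 3 4 c_def[symmetric] .
qed

text \<open>The form used by the next two inductions: \<open>A\<close> carries \<open>r\<close>
  parts of average size and \<open>W - A\<close> is one new part. The condition at
  \<open>r = 0\<close> is there because \<open>card A / 0 = 0\<close>.\<close>

lemma choose_mean_card_le:
  assumes "finite W" "A \<subseteq> W" "r = 0 \<longrightarrow> A = {}"
  shows "(r choose Suc k) * (card A / r) ^ Suc k + (r choose k) * (card A / r) ^ k * card (W - A)
    \<le> (Suc r choose Suc k) * (card W / Suc r) ^ Suc k"
proof -
  have "r * (card A / r) = real (card A)" using assms(3) by auto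
  moreover have "card A + card (W - A) = card W"
    using assms by (metis card_Diff_subset card_mono finite_subset le_add_diff_inverse)
  ultimately have "real r * (card A / r) + card (W - A) = card W" by linarith
  then show ?thesis using choose_mean_le[of "card A / r" "card (W - A)" r k] by simp
qed

text \<open>Take the vertex \<open>x\<close> in the most \<open>k\<close>-cliques and let
  \<open>A\<close> be its neighbourhood. Each vertex outside \<open>A\<close> lies in at most as
  many \<open>k\<close>-cliques as \<open>x\<close>, and this number is a clique count inside
  \<open>A\<close>, where the induction hypothesis applies.\<close>

lemma nclq_le_zykov:
  assumes "finite W" "nclq E (Suc r) W = 0"
  shows "nclq E k W \<le> (r choose k) * (card W / r) ^ k"
  using assms
proof (induction r arbitrary: W k)
  case 0
  then have "W = {}" using nclq_1[of E W] by simp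
  then show ?case by (cases k) (auto simp: nclq_0 nclq_empty)
next
  case (Suc r)
  show ?case
  proof (cases "k = 0 \<or> W = {}")
    case True
    then show ?thesis using Suc by (cases k) (auto simp: nclq_0 nclq_empty)
  next
    case False
    then obtain j where k: "k = Suc j" by (metis not0_implies_Suc)
    let ?f = "\<lambda>v. nclq E j (W \<inter> nbrs E v)"
    obtain x where x: "x \<in> W" "\<And>v. v \<in> W \<Longrightarrow> ?f v \<le> ?f x"
      using False Suc.prems(1) obtain_max[of W ?f] by blast
    define A where "A = W \<inter> nbrs E x"
    have A: "finite A" "A \<subseteq> W" "nclq E (Suc r) A = 0"
      using Suc.prems nclq_free_nbrs[OF _ x(1), of E "Suc r"] by (auto simp: A_def)
    have A0: "r = 0 \<longrightarrow> A = {}" using A(1,3) nclq_1[of E A] by auto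
    have IH: "nclq E i A \<le> (r choose i) * (card A / r) ^ i" for i
      using Suc.IH A by blast
    have "nclq E k W \<le> nclq E k (W - (W - A)) + (\<Sum>v\<in>W - A. ?f v)"
      unfolding k using Suc.prems by (intro nclq_Diff_le) auto
    also have "W - (W - A) = A" using A by auto
    also have "(\<Sum>v\<in>W - A. ?f v) \<le> card (W - A) * nclq E j A"
      using sum_bounded_above[of "W - A" ?f "nclq E j A"] x by (simp add: A_def)
    finally have "real (nclq E k W) \<le> nclq E k A + card (W - A) * real (nclq E j A)"
      by (simp flip: of_nat_mult of_nat_add)
    also have "\<dots> \<le> (r choose k) * (card A / r) ^ k + card (W - A) * ((r choose j) * (card A / r) ^ j)"
      using IH by (intro add_mono mult_left_mono) auto
    also have "\<dots> \<le> (Suc r choose Suc j) * (card W / Suc r) ^ Suc j"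
      using choose_mean_card_le[OF Suc.prems(1) A(2) A0, of j] unfolding k by (simp add: algebra_simps)
    finally show ?thesis unfolding k .
  qed
qed

text \<open>The same recursion with \<open>x\<close> of maximum degree; the vertices outside its
  neighbourhood form the new part. The degree sum over that part counts its inner edges twice, so
  the Turan bound leaves room for these edges a second time. A graph close to the bound thus has few
  edges inside the parts.\<close>

lemma furedi_partition:
  assumes "finite W" "nclq E (Suc r) W = 0"
  shows "\<exists>P. (\<Union>i<r. P i) = W \<and> disjoint_family_on P {..<r} \<and>
    (\<Sum>i<r. nclq E 2 (P i)) + nclq E 2 W \<le> (r choose 2) * (card W / r)\<^sup>2"
  using assms
proof (induction r arbitrary: W)
  case 0
  then have "W = {}" using nclq_1[of E W] by simp
  then show ?case by (auto simp: disjoint_family_on_def nclq_empty)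
next
  case (Suc r)
  show ?case
  proof (cases "W = {}")
    case True
    then show ?thesis
      by (intro exI[of _ "\<lambda>_. {}"]) (auto simp: disjoint_family_on_def nclq_empty)
  next
    case False
    let ?f = "\<lambda>v. card (W \<inter> nbrs E v)"
    obtain x where x: "x \<in> W" "\<And>v. v \<in> W \<Longrightarrow> ?f v \<le> ?f x"
      using False Suc.prems(1) obtain_max[of W ?f] by blast
    define A where "A = W \<inter> nbrs E x"
    have A: "finite A" "A \<subseteq> W" "nclq E (Suc r) A = 0"
      using Suc.prems nclq_free_nbrs[OF _ x(1), of E "Suc r"] by (auto simp: A_def)
    have A0: "r = 0 \<longrightarrow> A = {}" using A(1,3) nclq_1[of E A] by auto
    obtain P where P: "(\<Union>i<r. P i) = A" "disjoint_family_on P {..<r}"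
      "(\<Sum>i<r. nclq E 2 (P i)) + nclq E 2 A \<le> (r choose 2) * (card A / r)\<^sup>2"
      using Suc.IH[OF A(1,3)] by blast
    define P' where "P' = P(r := W - A)"
    have "nclq E 2 W + nclq E 2 (W - A) = nclq E 2 (W - (W - A)) + (\<Sum>v\<in>W - A. ?f v)"
      using Suc.prems by (intro nclq_2_Diff_eq) auto
    also have "W - (W - A) = A" using A by auto
    also have "(\<Sum>v\<in>W - A. ?f v) \<le> card (W - A) * card A"
      using sum_bounded_above[of "W - A" ?f "card A"] x by (simp add: A_def)
    finally have 1: "nclq E 2 W + nclq E 2 (W - A) \<le> nclq E 2 A + card (W - A) * card A" by simp
    have "(\<Sum>i<Suc r. nclq E 2 (P' i)) = (\<Sum>i<r. nclq E 2 (P i)) + nclq E 2 (W - A)"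
      by (simp add: P'_def)
    then have "real ((\<Sum>i<Suc r. nclq E 2 (P' i)) + nclq E 2 W)
        \<le> real ((\<Sum>i<r. nclq E 2 (P i)) + nclq E 2 A) + card (W - A) * real (card A)"
      using 1 by (simp flip: of_nat_mult of_nat_add of_nat_sum)
    also have "\<dots> \<le> (r choose 2) * (card A / r)\<^sup>2 + r * (card A / r) * card (W - A)"
      using P(3) A0 by auto
    also have "\<dots> \<le> (Suc r choose 2) * (card W / Suc r)\<^sup>2"
      using choose_mean_card_le[OF Suc.prems(1) A(2) A0, of 1] by (simp add: numeral_2_eq_2)
    finally have "real ((\<Sum>i<Suc r. nclq E 2 (P' i)) + nclq E 2 W) \<le> (Suc r choose 2) * (card W / Suc r)\<^sup>2" .
    moreover have "(\<Union>i<Suc r. P' i) = W"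
      using P(1) A(2) by (auto simp: P'_def lessThan_Suc)
    moreover have "disjoint_family_on P' {..<Suc r}"
      using P(1,2) unfolding disjoint_family_on_def P'_def lessThan_Suc by fastforce
    ultimately show ?thesis by blast
  qed
qed

section \<open>Deleting vertices of small degree\<close>

text \<open>The part size of the balanced complete \<open>r\<close>-partite graph with as many edges as \<open>W\<close> spans.\<close>

definition side :: "nat \<Rightarrow> 'a set set \<Rightarrow> 'a set \<Rightarrow> real" where
  "side r E W = sqrt (nclq E 2 W / (r choose 2))"

text \<open>The shift by \<open>1\<close> absorbs the second-order error of deleting a single vertex.\<close>

definition defect :: "nat \<Rightarrow> nat \<Rightarrow> 'a set set \<Rightarrow> 'a set \<Rightarrow> real" where
  "defect r s E W = (r choose s) * (side r E W + 1) ^ s - nclq E s W"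

lemma side_nonneg: "0 \<le> side r E W"
  by (simp add: side_def)

lemma choose_side_sq:
  assumes "0 < p"
  shows "(Suc p choose 2) * (side (Suc p) E W)\<^sup>2 = nclq E 2 W"
proof -
  have "0 < (Suc p choose 2)" using assms by (simp add: zero_less_binomial)
  then have "real (Suc p choose 2) > 0" by (simp only: of_nat_0_less_iff)
  then show ?thesis by (simp add: side_def del: binomial_Suc_Suc)
qed

lemma side_sq:
  assumes "0 < p"
  shows "Suc p * p * (side (Suc p) E W)\<^sup>2 = 2 * nclq E 2 W"
proof -
  have "Suc p * p = 2 * (Suc p choose 2)"
    using Suc_times_binomial_eq[of p 1] by (simp add: numeral_2_eq_2)
  then have "real (Suc p) * p = 2 * real (Suc p choose 2)" by (metis of_nat_mult of_nat_numeral)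
  then have "Suc p * p * (side (Suc p) E W)\<^sup>2 = 2 * ((Suc p choose 2) * (side (Suc p) E W)\<^sup>2)"
    by (simp only: of_nat_mult mult.assoc[symmetric])
  then show ?thesis unfolding choose_side_sq[OF assms, of E W] by (simp only: of_nat_mult of_nat_numeral)
qed

text \<open>Let the degree of \<open>v\<close> be \<open>x * p * q\<close>. The neighbourhood has no
  \<open>Suc p\<close>-clique, so by Zykov at most \<open>(p choose Suc j) * (x * q) ^ Suc j\<close>
  cliques are lost, while the main term drops by at least
  \<open>(p choose Suc j) * x * q ^ Suc j\<close>. The two differ by the factor
  \<open>x ^ j \<le> c ^ j\<close>.\<close>

lemma defect_delete:
  fixes c :: real
  assumes fin: "finite W" and v: "v \<in> W" and p: "0 < p" and free: "nclq E (Suc (Suc p)) W = 0"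
    and c: "0 \<le> c" "c \<le> 1" and d: "card (W \<inter> nbrs E v) \<le> c * p * side (Suc p) E W"
  shows "(p choose Suc j) * side (Suc p) E W ^ j * (card (W \<inter> nbrs E v) / p) * (1 - c ^ j)
    \<le> defect (Suc p) (Suc (Suc j)) E W - defect (Suc p) (Suc (Suc j)) E (W - {v})"
proof -
  define q q' where "q = side (Suc p) E W" and "q' = side (Suc p) E (W - {v})"
  \<comment> \<open>If \<open>q = 0\<close>, then \<open>d\<close> forces degree \<open>0\<close>,
    which the default value \<open>0\<close> matches.\<close>
  define x where "x = (if q = 0 then 0 else card (W \<inter> nbrs E v) / (p * q))"
  \<comment> \<open>The first-order drop of the part size: \<open>q\<^sup>2 - q'\<^sup>2\<close>
    equals \<open>2 * h * q\<close>, and \<open>q' \<le> q\<close> turns this into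
    \<open>q' \<le> q - h\<close>.\<close>
  define h where "h = x / Suc p"
  have q: "0 \<le> q" "0 \<le> q'" by (simp_all add: q_def q'_def side_nonneg)
  have dx: "card (W \<inter> nbrs E v) = x * p * q"
    using d p by (auto simp: x_def q_def[symmetric])
  have x: "0 \<le> x" "x \<le> c"
    using q d p c by (auto simp: x_def q_def[symmetric] divide_simps mult.assoc)
  have h: "0 \<le> h" "h \<le> 1" and hx: "Suc p * h = x" using x c by (auto simp: h_def)
  have e: "nclq E 2 W = nclq E 2 (W - {v}) + card (W \<inter> nbrs E v)"
    using nclq_Suc_eq[OF fin v, of E 1] by (simp add: nclq_1[unfolded One_nat_def] numeral_2_eq_2)
  have "Suc p * p * (q\<^sup>2 - q'\<^sup>2) = 2 * real (card (W \<inter> nbrs E v))"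
    using side_sq[OF p, of E W] side_sq[OF p, of E "W - {v}"] e
    by (simp add: q_def q'_def algebra_simps)
  also have "\<dots> = 2 * ((Suc p * h) * p * q)" unfolding dx hx by simp
  finally have "(Suc p * p) * (q\<^sup>2 - q'\<^sup>2) = (Suc p * p) * (2 * h * q)" by (simp only: of_nat_mult ac_simps)
  then have diff: "q\<^sup>2 - q'\<^sup>2 = 2 * h * q" using p by (simp only: mult_cancel_left of_nat_eq_0_iff) simp
  moreover have "0 \<le> 2 * h * q" using h q by simp
  ultimately have "q'\<^sup>2 \<le> q\<^sup>2" by linarith
  then have le: "q' \<le> q" using q(1) by (rule power2_le_imp_le)
  have "q' \<le> q - h"
  proof (cases "q = 0")
    case True
    then show ?thesis using le by (simp add: h_def x_def)
  next
    case False
    have "h * (2 * q) = (q - q') * (q + q')"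
      using diff by (simp add: algebra_simps power2_eq_square)
    also have "\<dots> \<le> (q - q') * (2 * q)"
      using le by (intro mult_left_mono) auto
    finally show ?thesis using False q by simp
  qed
  then have "(q' + 1) ^ Suc (Suc j) \<le> (q + 1 - h) ^ Suc (Suc j)"
    using q by (intro power_mono) auto
  \<comment> \<open>Tangent at \<open>q + 1 - h\<close>. Since \<open>h \<le> 1\<close>, the shift
    in \<open>defect\<close> keeps this base at least \<open>q\<close>, so no second-order error
    remains.\<close>
  also have "\<dots> \<le> (q + 1) ^ Suc (Suc j) - Suc (Suc j) * (q + 1 - h) ^ Suc j * h"
    using power_tangent_le[of "q + 1 - h" "q + 1" "Suc j"] q h by simp
  also have "\<dots> \<le> (q + 1) ^ Suc (Suc j) - Suc (Suc j) * q ^ Suc j * h"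
    using q h by (intro diff_left_mono mult_right_mono mult_left_mono power_mono) auto
  finally have "(Suc p choose Suc (Suc j)) * (q' + 1) ^ Suc (Suc j)
      \<le> (Suc p choose Suc (Suc j)) * ((q + 1) ^ Suc (Suc j) - Suc (Suc j) * q ^ Suc j * h)"
    by (rule mult_left_mono) simp
  also have "\<dots> = (Suc p choose Suc (Suc j)) * (q + 1) ^ Suc (Suc j)
      - real (Suc (Suc j)) * (Suc p choose Suc (Suc j)) * (q ^ Suc j * h)"
    by (simp only: algebra_simps)
  also have "real (Suc (Suc j)) * (Suc p choose Suc (Suc j)) = Suc p * (p choose Suc j)"
    using Suc_times_binomial_eq[of p "Suc j"] by (metis mult.commute of_nat_mult)
  also have "real (Suc p * (p choose Suc j)) * (q ^ Suc j * h) = (p choose Suc j) * (q ^ Suc j * x)"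
    unfolding hx[symmetric] by (simp add: algebra_simps)
  finally have 1: "(p choose Suc j) * (q ^ Suc j * x) \<le> (Suc p choose Suc (Suc j)) * (q + 1) ^ Suc (Suc j)
      - (Suc p choose Suc (Suc j)) * (q' + 1) ^ Suc (Suc j)" by linarith
  have "nclq E (Suc j) (W \<inter> nbrs E v) \<le> (p choose Suc j) * (card (W \<inter> nbrs E v) / p) ^ Suc j"
    using nclq_le_zykov[of "W \<inter> nbrs E v" E p "Suc j"] nclq_free_nbrs[OF fin v free] fin by simp
  also have "card (W \<inter> nbrs E v) / p = x * q" using dx p by simp
  finally have 2: "real (nclq E (Suc (Suc j)) W) - nclq E (Suc (Suc j)) (W - {v})
      \<le> (p choose Suc j) * (x * q) ^ Suc j"
    using nclq_Suc_eq[OF fin v, of E "Suc j"] by simp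
  have "(p choose Suc j) * q ^ j * (card (W \<inter> nbrs E v) / p) * (1 - c ^ j)
      = (p choose Suc j) * (q ^ Suc j * x) * (1 - c ^ j)" using dx p by simp
  also have "\<dots> \<le> (p choose Suc j) * (q ^ Suc j * x) * (1 - x ^ j)"
    using x q by (intro mult_left_mono diff_left_mono power_mono) auto
  also have "\<dots> = (p choose Suc j) * (q ^ Suc j * x) - (p choose Suc j) * (x * q) ^ Suc j"
    by (simp add: algebra_simps power_mult_distrib)
  finally show ?thesis using 1 2 unfolding defect_def q_def[symmetric] q'_def[symmetric] by linarith
qed

text \<open>Compare the degree sum, at least \<open>card W * c * p * q\<close> for the part size
  \<open>q\<close>, with twice the number of edges, \<open>Suc p * p * q\<^sup>2\<close>.\<close>

lemma card_le_side:
  fixes c :: real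
  assumes fin: "finite W" and p: "0 < p" and c: "0 \<le> c"
    and deg: "\<And>v. v \<in> W \<Longrightarrow> c * p * side (Suc p) E W \<le> card (W \<inter> nbrs E v)"
    and pos: "0 < side (Suc p) E W"
  shows "c * card W \<le> Suc p * side (Suc p) E W"
proof -
  let ?q = "side (Suc p) E W"
  have "card W * (c * p * ?q) \<le> (\<Sum>v\<in>W. real (card (W \<inter> nbrs E v)))"
    using deg by (intro sum_bounded_below) auto
  also have "\<dots> = 2 * nclq E 2 W" using handshake[OF fin, of E] by (simp flip: of_nat_sum)
  also have "\<dots> = Suc p * p * ?q\<^sup>2" by (rule side_sq[OF p, symmetric])
  finally have "(c * card W) * (p * ?q) \<le> (Suc p * ?q) * (p * ?q)"
    by (simp add: algebra_simps power2_eq_square)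
  then show ?thesis using p pos by (simp only: mult_le_cancel_right) (simp add: zero_less_mult_iff)
qed

text \<open>Delete vertices of degree at most \<open>p * q\<close>, where \<open>q\<close> is the
  current part size; by \<open>defect_delete\<close> with \<open>c = 1\<close> the defect does not
  grow. Once all degrees exceed this, at most \<open>Suc p * q\<close> vertices remain and Zykov's
  bound suffices.\<close>

lemma defect_nonneg:
  assumes "finite W" "0 < p" "nclq E (Suc (Suc p)) W = 0"
  shows "0 \<le> defect (Suc p) (Suc (Suc j)) E W"
  using assms
proof (induction "card W" arbitrary: W)
  case 0
  then show ?case by (simp add: defect_def nclq_empty side_nonneg del: binomial_Suc_Suc)
next
  case (Suc n)
  let ?q = "side (Suc p) E W"
  show ?case
  proof (cases "\<exists>v\<in>W. card (W \<inter> nbrs E v) \<le> (1 :: real) * p * ?q")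
    case True
    then obtain v where v: "v \<in> W" "card (W \<inter> nbrs E v) \<le> (1 :: real) * p * ?q" by blast
    have "nclq E (Suc (Suc p)) (W - {v}) = 0"
      using nclq_mono[of W "W - {v}" E "Suc (Suc p)"] Suc.prems by auto
    then have "0 \<le> defect (Suc p) (Suc (Suc j)) E (W - {v})"
      using Suc.hyps Suc.prems v by (intro Suc.hyps(1)) auto
    then show ?thesis using defect_delete[OF Suc.prems(1) v(1) Suc.prems(2,3) _ _ v(2), of j] by simp
  next
    case False
    have "0 < ?q"
    proof (rule ccontr)
      assume "\<not> 0 < ?q"
      then have "?q = 0" using side_nonneg[of "Suc p" E W] by linarith
      then have "nclq E 2 W = 0" using side_sq[OF Suc.prems(2), of E W] by simp
      then have "card (W \<inter> nbrs E v) = 0" if "v \<in> W" for v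
        using handshake[OF Suc.prems(1), of E] that Suc.prems(1) by simp
      moreover obtain v where "v \<in> W" using Suc.hyps(2) by fastforce
      ultimately show False using False \<open>?q = 0\<close> by auto
    qed
    then have "(1 :: real) * card W \<le> Suc p * ?q"
      using False Suc.prems by (intro card_le_side) force+
    then have "card W / Suc p \<le> ?q" by (simp add: divide_simps mult.commute)
    then have "(card W / Suc p) ^ Suc (Suc j) \<le> (?q + 1) ^ Suc (Suc j)"
      using side_nonneg[of "Suc p" E W] by (intro power_mono) auto
    then have "(Suc p choose Suc (Suc j)) * (card W / Suc p) ^ Suc (Suc j)
        \<le> (Suc p choose Suc (Suc j)) * (?q + 1) ^ Suc (Suc j)"
      by (rule mult_left_mono) simp
    then show ?thesis using nclq_le_zykov[OF Suc.prems(1,3), of "Suc (Suc j)"]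
      unfolding defect_def by linarith
  qed
qed

text \<open>Delete vertices of degree at most \<open>(1 - \<eta>) * p * q\<close> while the part
  size \<open>q\<close> is at least \<open>Q\<close>, and add up the gains of
  \<open>defect_delete\<close>. The gain per edge grows with \<open>q ^ j\<close>, so a uniform rate
  requires stopping below \<open>Q\<close>.\<close>

lemma dense_core:
  fixes \<eta> Q :: real
  assumes "finite W" "0 < p" "nclq E (Suc (Suc p)) W = 0" "0 < j" "0 \<le> \<eta>" "\<eta> \<le> 1" "0 \<le> Q"
  shows "\<exists>H\<subseteq>W. (side (Suc p) E H < Q \<or>
      (\<forall>v\<in>H. (1 - \<eta>) * p * side (Suc p) E H \<le> card (H \<inter> nbrs E v))) \<and>
    (p choose Suc j) * Q ^ j * \<eta> / p * (real (nclq E 2 W) - nclq E 2 H)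
      \<le> defect (Suc p) (Suc (Suc j)) E W - defect (Suc p) (Suc (Suc j)) E H"
  using assms
proof (induction "card W" arbitrary: W)
  case 0
  then show ?case by (intro exI[of _ W]) auto
next
  case (Suc n)
  let ?q = "side (Suc p) E"
  let ?D = "defect (Suc p) (Suc (Suc j)) E"
  let ?K = "(p choose Suc j) * Q ^ j * \<eta> / p"
  show ?case
  proof (cases "?q W < Q \<or> (\<forall>v\<in>W. (1 - \<eta>) * p * ?q W \<le> card (W \<inter> nbrs E v))")
    case True
    then show ?thesis by (intro exI[of _ W]) auto
  next
    case False
    then obtain v where v: "v \<in> W" "card (W \<inter> nbrs E v) \<le> (1 - \<eta>) * p * ?q W" and Q: "Q \<le> ?q W"
      by (auto simp: not_le less_imp_le)
    have "nclq E (Suc (Suc p)) (W - {v}) = 0"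
      using nclq_mono[of W "W - {v}" E "Suc (Suc p)"] Suc.prems by auto
    moreover have "n = card (W - {v})" using Suc.hyps(2) v(1) Suc.prems(1) by simp
    ultimately obtain H where H: "H \<subseteq> W - {v}"
      "?q H < Q \<or> (\<forall>v\<in>H. (1 - \<eta>) * p * ?q H \<le> card (H \<inter> nbrs E v))"
      "?K * (real (nclq E 2 (W - {v})) - nclq E 2 H) \<le> ?D (W - {v}) - ?D H"
      using Suc.hyps(1)[of "W - {v}"] Suc.prems by auto
    have e: "nclq E 2 W = nclq E 2 (W - {v}) + card (W \<inter> nbrs E v)"
      using nclq_Suc_eq[OF Suc.prems(1) v(1), of E 1] by (simp add: nclq_1[unfolded One_nat_def] numeral_2_eq_2)
    \<comment> \<open>Here \<open>s \<ge> 3\<close> enters, as \<open>0 < j\<close>: for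
      \<open>j = 0\<close> the gain \<open>1 - (1 - \<eta>) ^ j\<close> would vanish.\<close>
    have "(1 - \<eta>) ^ j \<le> 1 - \<eta>"
      using power_decreasing[of 1 j "1 - \<eta>"] Suc.prems by simp
    then have "\<eta> \<le> 1 - (1 - \<eta>) ^ j" by simp
    then have "(p choose Suc j) * Q ^ j * (card (W \<inter> nbrs E v) / p) * \<eta>
        \<le> (p choose Suc j) * ?q W ^ j * (card (W \<inter> nbrs E v) / p) * (1 - (1 - \<eta>) ^ j)"
      using Q Suc.prems side_nonneg[of "Suc p" E W]
      by (intro mult_mono mult_left_mono power_mono) auto
    also have "\<dots> \<le> ?D W - ?D (W - {v})"
      using Suc.prems by (intro defect_delete v) auto
    finally have "?K * card (W \<inter> nbrs E v) \<le> ?D W - ?D (W - {v})" by (simp add: mult_ac)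
    then have "?K * (real (nclq E 2 W) - nclq E 2 H) \<le> ?D W - ?D H"
      using H(3) unfolding e by (simp only: of_nat_add algebra_simps)
    then show ?thesis using H(1,2) by blast
  qed
qed

text \<open>The minimum degree bounds \<open>card W / Suc p\<close> by
  \<open>q / (1 - \<eta>)\<close>, so the Turan bound exceeds the number of edges by a factor of at
  most \<open>1 / (1 - \<eta>)\<^sup>2\<close>. Furedi's partition turns the excess into a bound on
  the edges inside parts.\<close>

lemma furedi_min_degree:
  assumes "finite W" "0 < p" "nclq E (Suc (Suc p)) W = 0" "\<eta> < 1" "0 < side (Suc p) E W"
    and deg: "\<And>v. v \<in> W \<Longrightarrow> (1 - \<eta>) * p * side (Suc p) E W \<le> card (W \<inter> nbrs E v)"
  shows "\<exists>P. (\<Union>i<Suc p. P i) = W \<and> disjoint_family_on P {..<Suc p} \<and>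
    (\<Sum>i<Suc p. nclq E 2 (P i)) \<le> (1 / (1 - \<eta>)\<^sup>2 - 1) * nclq E 2 W"
proof -
  let ?q = "side (Suc p) E W"
  obtain P where P: "(\<Union>i<Suc p. P i) = W" "disjoint_family_on P {..<Suc p}"
    "real ((\<Sum>i<Suc p. nclq E 2 (P i)) + nclq E 2 W) \<le> (Suc p choose 2) * (card W / Suc p)\<^sup>2"
    using furedi_partition[OF assms(1,3)] by blast
  have "(1 - \<eta>) * card W \<le> Suc p * ?q"
    by (intro card_le_side) (use assms in auto)
  then have "card W / Suc p \<le> ?q / (1 - \<eta>)"
    using assms(4) by (simp add: divide_simps mult.commute)
  then have "(card W / Suc p)\<^sup>2 \<le> (?q / (1 - \<eta>))\<^sup>2" by (intro power_mono) auto
  then have "(Suc p choose 2) * (card W / Suc p)\<^sup>2 \<le> (Suc p choose 2) * (?q / (1 - \<eta>))\<^sup>2"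
    by (rule mult_left_mono) simp
  also have "\<dots> = 1 / (1 - \<eta>)\<^sup>2 * ((Suc p choose 2) * ?q\<^sup>2)" by (simp add: power_divide)
  also have "\<dots> = 1 / (1 - \<eta>)\<^sup>2 * nclq E 2 W" using choose_side_sq[OF assms(2), of E W] by simp
  finally have "(\<Sum>i<Suc p. nclq E 2 (P i)) \<le> (1 / (1 - \<eta>)\<^sup>2 - 1) * nclq E 2 W"
    using P(3) by (simp only: of_nat_add left_diff_distrib)
  then show ?thesis using P(1,2) by blast
qed

section \<open>A lower bound for the extremal number\<close>

lemma cliques_2_edges:
  assumes "E \<subseteq> nsets V 2" "X \<subseteq> V"
  shows "cliques E 2 X = {e \<in> E. e \<subseteq> X}"
proof (intro subset_antisym subsetI)
  fix e assume "e \<in> cliques E 2 X"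
  then show "e \<in> {e \<in> E. e \<subseteq> X}"
    by (auto simp: cliques_def card_2_iff clique_def)
next
  fix e assume e: "e \<in> {e \<in> E. e \<subseteq> X}"
  then have "e \<in> nsets V 2" using assms by auto
  then obtain u v where "e = {u, v}" "u \<noteq> v" by (auto elim!: nsets2_E)
  then show "e \<in> cliques E 2 X"
    using e by (auto simp: cliques_def clique_def insert_commute)
qed

lemma kappa_eq_nclq: "simple_graph G \<Longrightarrow> kappa s G = nclq (edges G) s (verts G)"
  by (simp add: kappa_eq_card_cliques cliques_def)

lemma free_complete_iff:
  assumes "simple_graph G"
  shows "free (complete_graph k) G \<longleftrightarrow> nclq (edges G) k (verts G) = 0"
proof -
  \<comment> \<open>Finiteness matters because an infinite set of copies would also have
    \<open>card\<close> equal to \<open>0\<close>.\<close>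
  have "finite (nsets (verts G) 2)"
    using assms by (auto simp: simple_graph_def finite_imp_finite_nsets)
  then have "finite (Pow (verts G) \<times> Pow (edges G))"
    using assms finite_subset by (auto simp: simple_graph_def)
  moreover have "copies (complete_graph k) G \<subseteq> Pow (verts G) \<times> Pow (edges G)"
    by (auto simp: copies_def subgraph_def)
  ultimately have "finite (copies (complete_graph k) G)" by (rule finite_subset[rotated])
  then show ?thesis
    unfolding free_def kappa_eq_nclq[OF assms, symmetric] kappa_def by simp
qed

section \<open>Turan graphs with equal parts\<close>

text \<open>The parts are the residue classes modulo \<open>r\<close>, each with \<open>t\<close>
  vertices.\<close>

definition turan_edges :: "nat \<Rightarrow> nat \<Rightarrow> nat set set" where
  "turan_edges r t = {{u, v} | u v. u < r * t \<and> v < r * t \<and> u mod r \<noteq> v mod r}"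

lemma turan_edges_nsets: "turan_edges r t \<subseteq> nsets {..<r * t} 2"
  by (auto simp: turan_edges_def)

lemma doubleton_turan_edges:
  "{u, v} \<in> turan_edges r t \<longleftrightarrow> u < r * t \<and> v < r * t \<and> u mod r \<noteq> v mod r"
  by (auto simp: turan_edges_def doubleton_eq_iff)

lemma turan_free:
  assumes "0 < r"
  shows "cliques (turan_edges r t) (Suc r) {..<r * t} = {}"
proof (rule ccontr)
  assume "cliques (turan_edges r t) (Suc r) {..<r * t} \<noteq> {}"
  then obtain S where S: "card S = Suc r" "clique S (turan_edges r t)"
    by (auto simp: cliques_def)
  have "inj_on (\<lambda>v. v mod r) S"
    using S(2) by (auto simp: inj_on_def clique_def doubleton_turan_edges)
  moreover have "(\<lambda>v. v mod r) ` S \<subseteq> {..<r}" using assms by auto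
  ultimately have "card S \<le> card {..<r}" by (intro card_inj_on_le) auto
  then show False using S(1) by simp
qed

lemma card_turan_edges_le: "card (turan_edges r t) \<le> (r choose 2) * t\<^sup>2"
proof (cases "r = 0")
  case True
  then show ?thesis by (simp add: turan_edges_def)
next
  case False
  have "turan_edges r t = cliques (turan_edges r t) 2 {..<r * t}"
    using turan_edges_nsets[of r t] by (subst cliques_2_edges) (auto simp: nsets_def)
  moreover have "nclq (turan_edges r t) 2 {..<r * t} \<le> (r choose 2) * (card {..<r * t} / r)\<^sup>2"
    using turan_free[of r t] False by (intro nclq_le_zykov) auto
  moreover have "card {..<r * t} / r = real t" using False by simp
  ultimately have "real (card (turan_edges r t)) \<le> real ((r choose 2) * t\<^sup>2)" by simp
  then show ?thesis by (simp only: of_nat_le_iff)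
qed

text \<open>A clique arises from a set \<open>I\<close> of \<open>s\<close> residues and a choice of
  the vertex \<open>i + r * f i\<close> in each class \<open>i\<close>. Injectivity of this encoding
  suffices for a lower bound.\<close>

lemma nclq_turan_ge: "(r choose s) * t ^ s \<le> nclq (turan_edges r t) s {..<r * t}"
proof -
  define A where "A = (SIGMA I:{I. I \<subseteq> {..<r} \<and> card I = s}. I \<rightarrow>\<^sub>E {..<t})"
  define \<Phi> where "\<Phi> = (\<lambda>(I, f). (\<lambda>i. i + r * f i) ` I)"
  have mod: "(i + r * f i) mod r = i" if "I \<subseteq> {..<r}" "i \<in> I" for i I and f :: "nat \<Rightarrow> nat"
    using that by auto
  have fin: "finite {I. I \<subseteq> {..<r} \<and> card I = s}" by simp
  have "card A = (\<Sum>I | I \<subseteq> {..<r} \<and> card I = s. card (I \<rightarrow>\<^sub>E {..<t}))"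
    unfolding A_def by (rule card_SigmaI) (auto intro!: finite_PiE dest: finite_subset)
  also have "\<dots> = (\<Sum>I | I \<subseteq> {..<r} \<and> card I = s. t ^ s)"
    by (intro sum.cong) (auto simp: card_PiE dest: finite_subset)
  also have "\<dots> = (r choose s) * t ^ s" by (simp add: n_subsets)
  finally have card: "card A = (r choose s) * t ^ s" .
  have "inj_on \<Phi> A"
  proof (rule inj_onI, clarify)
    fix I f J g
    assume a: "(I, f) \<in> A" "(J, g) \<in> A" and eq: "\<Phi> (I, f) = \<Phi> (J, g)"
    have I: "I \<subseteq> {..<r}" "f \<in> I \<rightarrow>\<^sub>E {..<t}" and J: "J \<subseteq> {..<r}" "g \<in> J \<rightarrow>\<^sub>E {..<t}"
      using a by (auto simp: A_def)
    have "(\<lambda>v. v mod r) ` \<Phi> (I, f) = I" "(\<lambda>v. v mod r) ` \<Phi> (J, g) = J"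
      using mod[OF I(1)] mod[OF J(1)] by (simp_all add: \<Phi>_def image_image)
    then have IJ: "I = J" using eq by simp
    moreover have "f = g"
    proof (rule PiE_ext[OF I(2)])
      show "g \<in> I \<rightarrow>\<^sub>E {..<t}" using J(2) IJ by simp
      fix i assume i: "i \<in> I"
      then have "i + r * f i \<in> \<Phi> (J, g)" unfolding eq[symmetric] by (auto simp: \<Phi>_def)
      then obtain k where k: "k \<in> J" "i + r * f i = k + r * g k" by (auto simp: \<Phi>_def)
      have "i = k" using mod[OF I(1) i, of f] mod[OF J(1) k(1), of g] k(2) by simp
      moreover have "0 < r" using I(1) i by auto
      ultimately show "f i = g i" using k(2) by simp
    qed
    ultimately show "I = J \<and> f = g" by simp
  qed
  moreover have "\<Phi> ` A \<subseteq> cliques (turan_edges r t) s {..<r * t}"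
  proof clarify
    fix I f assume a: "(I, f) \<in> A"
    have I: "I \<subseteq> {..<r}" "card I = s" "\<And>i. i \<in> I \<Longrightarrow> f i < t" using a by (auto simp: A_def)
    have lt: "i + r * f i < r * t" if "i \<in> I" for i
    proof -
      have "i + r * f i < r * Suc (f i)" using I(1) that by auto
      also have "\<dots> \<le> r * t" using I(3)[OF that] by (intro mult_le_mono2) simp
      finally show ?thesis .
    qed
    have "inj_on (\<lambda>i. i + r * f i) I"
      using mod[OF I(1), of _ f] by (metis (no_types, lifting) inj_onI)
    then have "card (\<Phi> (I, f)) = s" using I(2) by (simp add: \<Phi>_def card_image)
    moreover have "clique (\<Phi> (I, f)) (turan_edges r t)"
      using lt mod[OF I(1), of _ f] by (auto simp: \<Phi>_def clique_def doubleton_turan_edges)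
    moreover have "\<Phi> (I, f) \<subseteq> {..<r * t}" using lt by (auto simp: \<Phi>_def)
    ultimately show "\<Phi> (I, f) \<in> cliques (turan_edges r t) s {..<r * t}" by (simp add: cliques_def)
  qed
  ultimately show ?thesis using card
    by (metis card_inj_on_le finite_cliques finite_lessThan)
qed

text \<open>A pendant star brings the number of edges of the Turan graph to exactly \<open>m\<close>.\<close>

lemma mex_ge:
  assumes "2 \<le> s" "2 \<le> r" "(r choose 2) * t\<^sup>2 \<le> m"
  shows "(r choose s) * t ^ s \<le> mex (complete_graph s) m (complete_graph (r + 1))"
proof -
  \<comment> \<open>\<open>c\<close> is the first number past the Turan graph. It becomes the centre
    of a star, disjoint from that graph, whose \<open>l\<close> edges make up for the missing
    ones.\<close>
  define c l where "c = r * t" and "l = m - card (turan_edges r t)"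
  define F where "F = (\<lambda>i. {c, c + i}) ` {1..l}"
  define G where "G = ({..c + l}, turan_edges r t \<union> F)"
  have F: "F \<subseteq> nsets {..c + l} 2" by (auto simp: F_def)
  have T: "turan_edges r t \<subseteq> nsets {..c + l} 2"
    by (rule subset_trans[OF turan_edges_nsets nsets_mono]) (auto simp: c_def)
  have G: "simple_graph G" using F T by (simp add: simple_graph_def G_def)
  have disj: "turan_edges r t \<inter> F = {}" by (auto simp: F_def doubleton_turan_edges c_def)
  have finT: "finite (turan_edges r t)"
    by (rule finite_subset[OF turan_edges_nsets]) (simp add: finite_imp_finite_nsets)
  have finF: "finite F" by (simp add: F_def)
  have "card F = l" unfolding F_def by (auto simp: card_image inj_on_def doubleton_eq_iff)
  then have "card (edges G) = card (turan_edges r t) + l"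
    using card_Un_disjoint[OF finT finF disj] by (simp add: G_def)
  then have m: "card (edges G) = m"
    using le_trans[OF card_turan_edges_le assms(3)] by (simp add: l_def)
  have cT: "u < c \<and> v < c" if "{u, v} \<in> turan_edges r t" for u v
    using that by (auto simp: doubleton_turan_edges c_def)
  have cF: "c \<le> u \<and> c \<le> v \<and> (u = c \<or> v = c)" if "{u, v} \<in> F" for u v
  proof -
    from that obtain i where "{u, v} = {c, c + i}" unfolding F_def by blast
    then have "u = c \<and> v = c + i \<or> u = c + i \<and> v = c" by (simp only: doubleton_eq_iff)
    then show ?thesis by fastforce
  qed
  have "cliques (edges G) (r + 1) (verts G) = {}"
  proof (rule ccontr)
    assume "cliques (edges G) (r + 1) (verts G) \<noteq> {}"
    then obtain S where S: "card S = r + 1" "clique S (turan_edges r t \<union> F)"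
      by (auto simp: cliques_def G_def)
    have adj: "{u, v} \<in> turan_edges r t \<or> {u, v} \<in> F" if "u \<in> S" "v \<in> S" "u \<noteq> v" for u v
      using S(2) that by (auto simp: clique_def)
    \<comment> \<open>A clique has at least three vertices, as \<open>r \<ge> 2\<close>. One vertex
      in the star would pull two others into it, but a star has no triangle.\<close>
    have low: "u < c" if u: "u \<in> S" for u
    proof (rule ccontr)
      assume "\<not> u < c"
      have "2 \<le> card (S - {u})" using S(1) u assms(2) by simp
      then obtain T where "T \<subseteq> S - {u}" "card T = 2" by (meson obtain_subset_with_card_n)
      then obtain v w where "v \<in> S" "w \<in> S" "v \<noteq> u" "w \<noteq> u" "v \<noteq> w"
        by (auto simp: card_2_iff)
      then have "{u, v} \<in> F" "{u, w} \<in> F" and vw: "{v, w} \<in> turan_edges r t \<or> {v, w} \<in> F"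
        using adj[OF u, of v] adj[OF u, of w] adj[of v w] cT[of u v] cT[of u w] \<open>\<not> u < c\<close> by auto
      then have "c \<le> v" "c \<le> w" "u = c \<or> v = c" "u = c \<or> w = c"
        using cF by blast+
      moreover from this have "v = c \<or> w = c" using vw cT[of v w] cF[of v w] by auto
      ultimately show False using \<open>v \<noteq> u\<close> \<open>w \<noteq> u\<close> \<open>v \<noteq> w\<close> by auto
    qed
    have "clique S (turan_edges r t)"
      unfolding clique_def
    proof (intro ballI impI)
      fix u v assume "u \<in> S" "v \<in> S" "u \<noteq> v"
      then show "{u, v} \<in> turan_edges r t" using adj[of u v] cF[of u v] low[of u] by auto
    qed
    then have "S \<in> cliques (turan_edges r t) (Suc r) {..<r * t}"
      using S(1) low by (auto simp: cliques_def c_def)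
    then show False using turan_free[of r t] assms(2) by simp
  qed
  then have free: "free (complete_graph (r + 1)) G" using free_complete_iff[OF G] by simp
  have "(r choose s) * t ^ s \<le> nclq (turan_edges r t) s {..<r * t}" by (rule nclq_turan_ge)
  also have "\<dots> \<le> nclq (edges G) s (verts G)"
    by (intro card_mono finite_cliques) (auto simp: cliques_def G_def clique_def c_def)
  also have "\<dots> = card (copies (complete_graph s) G)"
    using kappa_eq_nclq[OF G] by (simp add: kappa_def)
  also have "\<dots> \<le> mex (complete_graph s) m (complete_graph (r + 1))"
    unfolding mex_def using G m free by (intro Max_ge finite_mex_complete assms(1)) blast
  finally show ?thesis .
qed

text \<open>After division by \<open>q ^ s\<close> the left side is continuous in
  \<open>1 / q\<close> and tends to \<open>C * \<delta>\<close>.\<close>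

lemma eventually_gap_le:
  fixes C \<delta> K :: real
  assumes "C * \<delta> < K"
  shows "\<forall>\<^sub>F q in at_top. C * ((q + 1) ^ s - (1 - \<delta>) * (q - 1) ^ s) \<le> K * q ^ s"
proof -
  have inv: "((\<lambda>q. inverse q) \<longlongrightarrow> (0 :: real)) at_top"
    by (rule tendsto_inverse_0_at_top[OF filterlim_ident])
  have "isCont (\<lambda>x. C * ((1 + x) ^ s - (1 - \<delta>) * (1 - x) ^ s)) 0"
    by (intro continuous_intros)
  from isCont_tendsto_compose[OF this inv]
  have "((\<lambda>q. C * ((1 + inverse q) ^ s - (1 - \<delta>) * (1 - inverse q) ^ s)) \<longlongrightarrow>
      C * ((1 + 0) ^ s - (1 - \<delta>) * (1 - 0) ^ s)) at_top" .
  moreover have "C * ((1 + 0) ^ s - (1 - \<delta>) * (1 - 0) ^ s) < K" using assms by simp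
  ultimately have "\<forall>\<^sub>F q in at_top. C * ((1 + inverse q) ^ s - (1 - \<delta>) * (1 - inverse q) ^ s) < K"
    by (rule order_tendstoD(2))
  then show ?thesis using eventually_gt_at_top[of 0]
  proof eventually_elim
    case (elim q)
    have eq: "(1 + inverse q) * q = q + 1" "(1 - inverse q) * q = q - 1"
      using elim(2) by (simp_all add: field_simps)
    have pow: "(q + 1) ^ s = (1 + inverse q) ^ s * q ^ s" "(q - 1) ^ s = (1 - inverse q) ^ s * q ^ s"
      by (simp_all only: power_mult_distrib[symmetric] eq)
    have "C * ((q + 1) ^ s - (1 - \<delta>) * (q - 1) ^ s)
        = C * ((1 + inverse q) ^ s - (1 - \<delta>) * (1 - inverse q) ^ s) * q ^ s"
      unfolding pow by (simp only: right_diff_distrib left_diff_distrib mult.assoc)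
    also have "\<dots> \<le> K * q ^ s"
      using elim by (intro mult_right_mono) auto
    finally show ?case .
  qed
qed

text \<open>Rounding \<open>q\<close> down to an integer part size loses at most
  \<open>1\<close>.\<close>

lemma mex_real_ge:
  fixes q :: real
  assumes "2 \<le> s" "2 \<le> r" "1 \<le> q" "(r choose 2) * q\<^sup>2 = m"
  shows "(r choose s) * (q - 1) ^ s \<le> mex (complete_graph s) m (complete_graph (r + 1))"
proof -
  define t where "t = nat \<lfloor>q\<rfloor>"
  have t: "real t \<le> q" "q - 1 \<le> real t" using assms(3) by (auto simp: t_def)
  have "real ((r choose 2) * t\<^sup>2) \<le> (r choose 2) * q\<^sup>2"
    using t(1) by (simp add: mult_left_mono power_mono)
  then have "(r choose 2) * t\<^sup>2 \<le> m" unfolding assms(4) by (simp only: of_nat_le_iff)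
  then have "(r choose s) * t ^ s \<le> mex (complete_graph s) m (complete_graph (r + 1))"
    by (rule mex_ge[OF assms(1,2)])
  moreover have "(r choose s) * (q - 1) ^ s \<le> (r choose s) * real t ^ s"
    using t assms(3) by (intro mult_left_mono power_mono) auto
  ultimately show ?thesis by (smt (verit) of_nat_le_iff of_nat_mult of_nat_power)
qed

section \<open>Stability\<close>

lemma partite_delete_core:
  assumes G: "simple_graph G" and H: "H \<subseteq> verts G" and P: "(\<Union>i<Suc p. P i) = H" "disjoint_family_on P {..<Suc p}"
  shows "\<exists>D\<subseteq>edges G. card D + nclq (edges G) 2 H \<le> card (edges G) + (\<Sum>i<Suc p. nclq (edges G) 2 (P i)) \<and>
    partite (Suc p) (delete_edges G D)"
proof -
  let ?E = "edges G" and ?V = "verts G"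
  have E: "?E \<subseteq> nsets ?V 2" and finV: "finite ?V" using G by (auto simp: simple_graph_def)
  have finE: "finite ?E" using finite_subset[OF E] finV by (simp add: finite_imp_finite_nsets)
  have PH: "P i \<subseteq> H" if "i < Suc p" for i using P(1) that by blast
  have cl: "cliques ?E 2 X = {e \<in> ?E. e \<subseteq> X}" if "X \<subseteq> ?V" for X
    using cliques_2_edges[OF E that] .
  \<comment> \<open>Delete every edge not inside \<open>H\<close> and every edge inside a
    part.\<close>
  define D where "D = (?E - cliques ?E 2 H) \<union> (\<Union>i<Suc p. cliques ?E 2 (P i))"
  \<comment> \<open>Vertices outside \<open>H\<close> lose all their edges, so they may join part
    \<open>0\<close>.\<close>
  define P' where "P' = (\<lambda>i. P i \<union> (if i = 0 then ?V - H else {}))"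
  have sub: "cliques ?E 2 H \<subseteq> ?E" and "\<And>i. i < Suc p \<Longrightarrow> cliques ?E 2 (P i) \<subseteq> ?E"
    using cl[OF H] cl PH H by blast+
  then have D: "D \<subseteq> ?E" unfolding D_def by blast
  have "card D \<le> card (?E - cliques ?E 2 H) + card (\<Union>i<Suc p. cliques ?E 2 (P i))"
    unfolding D_def by (rule card_Un_le)
  also have "card (\<Union>i<Suc p. cliques ?E 2 (P i)) \<le> (\<Sum>i<Suc p. nclq ?E 2 (P i))"
    by (rule card_UN_le) simp
  also have "card (?E - cliques ?E 2 H) = card ?E - nclq ?E 2 H"
    using sub finE by (meson card_Diff_subset finite_subset)
  finally have "card D + nclq ?E 2 H \<le> card ?E + (\<Sum>i<Suc p. nclq ?E 2 (P i))"
    using card_mono[OF finE sub] by simp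
  moreover have "partite (Suc p) (delete_edges G D)"
    unfolding partite_def delete_edges_def fst_conv snd_conv
  proof (intro exI[of _ P'] conjI allI impI)
    show "(\<Union>i<Suc p. P' i) = ?V"
      unfolding P'_def UN_Un_distrib P(1) using H by auto
    show "disjoint_family_on P' {..<Suc p}"
      unfolding disjoint_family_on_def
    proof (intro ballI impI)
      fix i k assume ik: "i \<in> {..<Suc p}" "k \<in> {..<Suc p}" "i \<noteq> k"
      then have "P i \<inter> P k = {}" "P i \<subseteq> H" "P k \<subseteq> H"
        using P(2) PH by (auto simp only: disjoint_family_on_def lessThan_iff)
      then show "P' i \<inter> P' k = {}" using ik(3) by (auto simp: P'_def)
    qed
    fix i assume i: "i < Suc p"
    show "indep (P' i) (?E - D)"
      unfolding indep_def
    proof (intro ballI impI notI)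
      fix u v assume uv: "u \<in> P' i" "v \<in> P' i" "{u, v} \<in> ?E - D"
      then have "{u, v} \<in> cliques ?E 2 H" by (auto simp: D_def)
      then have "{u, v} \<subseteq> H" using cl[OF H] by auto
      then have "{u, v} \<subseteq> P i" using uv by (auto simp: P'_def split: if_splits)
      then have "{u, v} \<in> cliques ?E 2 (P i)" using cl[of "P i"] PH[OF i] H uv(3) by auto
      then show False using uv(3) i by (auto simp: D_def)
    qed
  qed
  ultimately show ?thesis using D by blast
qed

theorem theorem1p11:
  fixes r s :: nat and \<epsilon> :: real
  assumes "3 \<le> s" and "s \<le> r" and "0 < \<epsilon>"
  shows "\<exists>(m0 :: nat) (\<delta> :: real). 0 < \<delta> \<and>
    (\<forall>(m :: nat) (G :: 'a graph).
       m0 \<le> m \<longrightarrow> simple_graph G \<longrightarrow> card (edges G) = m \<longrightarrow>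
       free (complete_graph (r + 1)) G \<longrightarrow>
       real (kappa s G) \<ge> (1 - \<delta>) * real (mex (complete_graph s) m (complete_graph (r + 1))) \<longrightarrow>
       (\<exists>D \<subseteq> edges G. real (card D) \<le> \<epsilon> * real m \<and> partite r (delete_edges G D)))"
proof -
  obtain j where s: "s = Suc (Suc j)" and j: "0 < j" using assms(1)
    by (metis One_nat_def Suc_le_D Suc_le_lessD numeral_3_eq_3 Suc_le_mono)
  obtain p where r: "r = Suc p" and p: "0 < p" "Suc j \<le> p" 
    using assms(1,2) s by (cases r) auto
  define a where "a = min \<epsilon> 1"
  \<comment> \<open>Half of the budget \<open>a * m\<close> pays for edges outside the core, half
    for edges inside parts. \<open>\<eta>\<close> meets the second half by \<open>\<eta>_le\<close>;
    a core with \<open>(1 - a / 2) * m\<close> edges has part size at least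
    \<open>\<theta> * q\<close>.\<close>
  define \<eta> \<theta> where "\<eta> = a / 8" and "\<theta> = sqrt (1 - a / 2)"
  have a: "0 < a" "a \<le> 1" "a \<le> \<epsilon>" using assms(3) by (auto simp: a_def)
  have \<eta>: "0 < \<eta>" "\<eta> < 1" using a by (auto simp: \<eta>_def)
  have \<theta>: "0 < \<theta>" "\<theta>\<^sup>2 = 1 - a / 2" using a by (auto simp: \<theta>_def)
  have \<eta>_le: "1 / (1 - \<eta>)\<^sup>2 - 1 \<le> a / 2"
  proof -
    have "0 \<le> a * (16 - 7 * a + a * a / 2) / 64" using a by simp
    also have "\<dots> = (1 + a / 2) * (1 - \<eta>)\<^sup>2 - 1"
      by (simp add: \<eta>_def power2_eq_square field_simps)
    finally have "1 \<le> (1 + a / 2) * (1 - \<eta>)\<^sup>2" by simp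
    moreover have "0 < (1 - \<eta>)\<^sup>2" using \<eta> by simp
    ultimately have "1 / (1 - \<eta>)\<^sup>2 \<le> 1 + a / 2" by (simp only: pos_divide_le_eq)
    then show ?thesis by simp
  qed
  define B where "B = real (r choose 2)"
  define C where "C = real (r choose s)"
  \<comment> \<open>\<open>K * q ^ s\<close> is the defect used up by losing
    \<open>a / 2 * m\<close> edges at the rate of \<open>dense_core\<close> for
    \<open>Q = \<theta> * q\<close>, since \<open>m = B * q\<^sup>2\<close>.\<close>
  define K where "K = (p choose Suc j) * \<theta> ^ j * \<eta> / p * (a / 2 * B)"
  \<comment> \<open>The factor \<open>2\<close> leaves \<open>C * \<delta> < K\<close>, the slack
    for \<open>eventually_gap_le\<close>; the cap keeps \<open>1 - \<delta>\<close>
    nonnegative.\<close>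
  define \<delta> where "\<delta> = min 1 (K / (2 * C))"
  have B: "0 < B" using p unfolding B_def r of_nat_0_less_iff by (simp add: zero_less_binomial)
  have C: "0 < C" using assms(2) by (simp add: C_def zero_less_binomial)
  have pj: "0 < real (p choose Suc j)" using p by (simp add: zero_less_binomial)
  have K: "0 < K" using a \<eta>(1) \<theta>(1) B pj p by (simp add: K_def)
  have \<delta>: "0 < \<delta>" "\<delta> \<le> 1" using K C by (auto simp: \<delta>_def)
  have "C * \<delta> \<le> C * (K / (2 * C))" using C by (intro mult_left_mono) (auto simp: \<delta>_def)
  also have "\<dots> = K / 2" using C by simp
  also have "\<dots> < K" using K by simp
  finally have "\<forall>\<^sub>F q in at_top. C * ((q + 1) ^ s - (1 - \<delta>) * (q - 1) ^ s) \<le> K * q ^ s"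
    by (rule eventually_gap_le)
  then obtain q0 where q0: "\<And>q. q0 \<le> q \<Longrightarrow> C * ((q + 1) ^ s - (1 - \<delta>) * (q - 1) ^ s) \<le> K * q ^ s"
    unfolding eventually_at_top_linorder by blast
  define q1 where "q1 = max q0 1"
  \<comment> \<open>From \<open>m0\<close> edges on, the part size \<open>q\<close> is at least
    \<open>q1\<close>.\<close>
  define m0 where "m0 = nat \<lceil>B * q1\<^sup>2\<rceil>"
  show ?thesis
  proof (intro exI[of _ m0] exI[of _ \<delta>] conjI \<delta>(1) allI impI)
    fix m and G :: "'a graph"
    assume m: "m0 \<le> m" and G: "simple_graph G" and eG: "card (edges G) = m"
      and free: "free (complete_graph (r + 1)) G"
      and many: "(1 - \<delta>) * real (mex (complete_graph s) m (complete_graph (r + 1))) \<le> real (kappa s G)"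
    define E V where "E = edges G" and "V = verts G"
    have finV: "finite V" and E: "E \<subseteq> nsets V 2" using G by (auto simp: simple_graph_def E_def V_def)
    have "cliques E 2 V = E" using cliques_2_edges[OF E order_refl] E by (auto simp: nsets_def)
    then have eV: "nclq E 2 V = m" using eG by (simp add: E_def)
    have freeV: "nclq E (Suc (Suc p)) V = 0"
      using free free_complete_iff[OF G, of "r + 1"] by (simp add: E_def V_def r)
    define q where "q = side r E V"
    have q: "B * q\<^sup>2 = m" using choose_side_sq[OF p(1), of E V] by (simp only: q_def B_def r eV)
    have "B * q1\<^sup>2 \<le> m" using m by (simp add: m0_def)
    then have "q1\<^sup>2 \<le> q\<^sup>2" using q B by (metis mult_le_cancel_left_pos)
    then have qq: "q0 \<le> q" "1 \<le> q"
      using power2_le_imp_le[of q1 q] side_nonneg[of r E V] by (auto simp: q_def q1_def)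
    have "(1 - \<delta>) * (C * (q - 1) ^ s)
        \<le> (1 - \<delta>) * mex (complete_graph s) m (complete_graph (r + 1))"
      using mex_real_ge[OF _ _ qq(2), of s r m] q assms \<delta>(2)
      by (intro mult_left_mono) (auto simp: B_def C_def)
    also have "\<dots> \<le> nclq E s V" using many kappa_eq_nclq[OF G] by (simp add: E_def V_def)
    finally have "defect r s E V \<le> C * ((q + 1) ^ s - (1 - \<delta>) * (q - 1) ^ s)"
      by (simp add: defect_def q_def C_def algebra_simps)
    also have "\<dots> \<le> K * q ^ s" by (rule q0[OF qq(1)])
    finally have defV: "defect r s E V \<le> K * q ^ s" .
    obtain H where H: "H \<subseteq> V" "side r E H < \<theta> * q \<or>
        (\<forall>v\<in>H. (1 - \<eta>) * p * side r E H \<le> card (H \<inter> nbrs E v))"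
      "(p choose Suc j) * (\<theta> * q) ^ j * \<eta> / p * (real (nclq E 2 V) - nclq E 2 H)
        \<le> defect r s E V - defect r s E H"
      using dense_core[OF finV p(1) freeV j, of \<eta> "\<theta> * q"] \<eta> \<theta> qq(2) unfolding r s by auto
    have finH: "finite H" using H(1) finV finite_subset by blast
    have freeH: "nclq E (Suc (Suc p)) H = 0"
      using nclq_mono[OF finV H(1), of E "Suc (Suc p)"] freeV by simp
    \<comment> \<open>The defect of \<open>H\<close> is nonnegative, so the total gain is at most
      the initial defect; this limits the edges lost.\<close>
    have "(p choose Suc j) * (\<theta> * q) ^ j * \<eta> / p * (real m - nclq E 2 H) \<le> K * q ^ s"
      using H(3) defV defect_nonneg[OF finH p(1) freeH, of j] unfolding eV r s by linarith
    also have "K * q ^ s = (p choose Suc j) * (\<theta> * q) ^ j * \<eta> / p * (a / 2 * (B * q\<^sup>2))"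
      by (simp add: K_def s power_mult_distrib power2_eq_square)
    finally have "real m - nclq E 2 H \<le> a / 2 * (B * q\<^sup>2)"
      using pj p(1) \<eta>(1) \<theta>(1) qq(2)
      by (subst (asm) mult_le_cancel_left_pos) auto
    then have eH: "real m - nclq E 2 H \<le> a / 2 * m" unfolding q .
    have "B * (\<theta> * q)\<^sup>2 = (1 - a / 2) * m"
      using q \<theta>(2) by (simp add: power_mult_distrib)
    also have "\<dots> \<le> nclq E 2 H" using eH by (simp add: algebra_simps)
    also have "\<dots> = B * (side r E H)\<^sup>2" using choose_side_sq[OF p(1), of E H] by (simp only: B_def r)
    finally have "(\<theta> * q)\<^sup>2 \<le> (side r E H)\<^sup>2" using B by (metis mult_le_cancel_left_pos)
    \<comment> \<open>This excludes the first alternative in \<open>H(2)\<close>, so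
      \<open>H\<close> has large minimum degree.\<close>
    then have qH: "\<theta> * q \<le> side r E H" using side_nonneg by (rule power2_le_imp_le)
    then have "0 < side r E H" using \<theta>(1) qq(2) by (smt (verit) mult_pos_pos)
    then obtain P where P: "(\<Union>i<Suc p. P i) = H" "disjoint_family_on P {..<Suc p}"
      "(\<Sum>i<Suc p. nclq E 2 (P i)) \<le> (1 / (1 - \<eta>)\<^sup>2 - 1) * nclq E 2 H"
      using furedi_min_degree[OF finH p(1) freeH \<eta>(2)] H(2) qH unfolding r by force
    note P(3)
    also have "(1 / (1 - \<eta>)\<^sup>2 - 1) * nclq E 2 H \<le> a / 2 * m"
      using \<eta>_le a(1) nclq_mono[OF finV H(1), of E 2] unfolding eV by (intro mult_mono) auto
    finally have sum: "(\<Sum>i<Suc p. nclq E 2 (P i)) \<le> a / 2 * m" .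
    obtain D where D: "D \<subseteq> edges G"
      "card D + nclq E 2 H \<le> m + (\<Sum>i<Suc p. nclq E 2 (P i))"
      "partite r (delete_edges G D)"
      using partite_delete_core[OF G H(1)[unfolded V_def] P(1,2)] unfolding r E_def eG by blast
    have "real (card D) + nclq E 2 H \<le> m + real (\<Sum>i<Suc p. nclq E 2 (P i))"
      using D(2) by (simp only: flip: of_nat_add of_nat_le_iff)
    then have "real (card D) \<le> a * m" using sum eH by linarith
    also have "\<dots> \<le> \<epsilon> * m" using a(3) by (intro mult_right_mono) auto
    finally show "\<exists>D\<subseteq>edges G. real (card D) \<le> \<epsilon> * real m \<and> partite r (delete_edges G D)"
      using D(1,3) by blast
  qed
qed

end
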